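(* Let $f(x)=\sum_{j=0}^nc_je^{\langle x,\alpha_j\rangle}+c_\beta e^{\langle x,\beta\rangle}$ be a circuit function with $A^+=\{\alpha_0,\ldots,\alpha_n\}\subset\mathbb{R}^n$, inner point $\beta$, and $c_\beta<0$. Then $f$ belongs to the DSONC cone $D_{A^+,\beta}$ if and only if the tropical hypersurface $\mathcal{T}\subset\mathbb{R}^n$ given by the tropical (max-plus) polynomial $$\max\Big\{\ \log|c_\alpha|+\langle x,\alpha\rangle\ (\alpha\in A^+),\ \ \log|c_\beta|+\langle x,\beta\rangle\ \Big\}$$ (where $c_{\alpha_j}=c_j$) has genus zero, i.e. its complement $\mathbb{R}^n\setminus\mathcal{T}$ contains no bounded connected component.
   Context: Circuit function here means: $A^+=\{\alpha_0,\dots,\alpha_n\}\subset\mathbb{R}^n$ is affinely independent, $\beta$ lies in the interior of the simplex $\mathrm{conv}(A^+)$, and $c_j>0$ for all $j$. The barycentric coordinates are the unique $\lambda\in(0,1)^{n+1}$ with $\sum_j\lambda_j\alpha_j=\beta$, $\sum_j\lambda_j=1$. DSONC cone of the circuit: $D_{A^+,\beta}$ is the set of all exponential sums $\sum_jd_je^{\langle x,\alpha_j\rangle}+d_\beta e^{\langle x,\beta\rangle}$ with $d_j\ge0$ for all $j$ and $-d_\beta\le\prod_{j=0}^nd_j^{\lambda_j}$. The tropical hypersurface of a max-plus polynomial $\max_i\ell_i(x)$ (a maximum of finitely many affine functions) is the set of $x\in\mathbb{R}^n$ at which the maximum is attained by at least two of the $\ell_i$. *)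

theory Defs
  imports "HOL-Analysis.Analysis"
begin

definition circuit :: "(real^'n) set \<Rightarrow> real^'n \<Rightarrow> bool" where
  "circuit A \<beta> \<longleftrightarrow> card A = CARD('n) + 1 \<and> \<not> affine_dependent A \<and> \<beta> \<in> interior (convex hull A)"

definition exp_sum ::
    "(real^'n) set \<Rightarrow> real^'n \<Rightarrow> (real^'n \<Rightarrow> real) \<Rightarrow> real \<Rightarrow> real^'n \<Rightarrow> real" where
  "exp_sum A \<beta> d d\<^sub>\<beta> = (\<lambda>x. (\<Sum>\<alpha>\<in>A. d \<alpha> * exp (x \<bullet> \<alpha>)) + d\<^sub>\<beta> * exp (x \<bullet> \<beta>))"

definition circuit_function ::
    "(real^'n) set \<Rightarrow> real^'n \<Rightarrow> (real^'n \<Rightarrow> real) \<Rightarrow> (real^'n \<Rightarrow> real) \<Rightarrow> bool" where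
  "circuit_function A \<beta> c f \<longleftrightarrow>
     circuit A \<beta> \<and> (\<forall>\<alpha>\<in>A. 0 < c \<alpha>) \<and> f = exp_sum A \<beta> c (c \<beta>)"

text \<open>The coordinates are set to zero outside \<open>A\<close>, so that the description determines a unique
  function whenever \<open>circuit A \<beta>\<close> holds.\<close>

definition barycentric_coords :: "(real^'n) set \<Rightarrow> real^'n \<Rightarrow> real^'n \<Rightarrow> real" where
  "barycentric_coords A \<beta> = (THE l.
     (\<forall>\<alpha>\<in>A. 0 < l \<alpha> \<and> l \<alpha> < 1) \<and> (\<forall>\<alpha>. \<alpha> \<notin> A \<longrightarrow> l \<alpha> = 0) \<and>
     (\<Sum>\<alpha>\<in>A. l \<alpha> *\<^sub>R \<alpha>) = \<beta> \<and> (\<Sum>\<alpha>\<in>A. l \<alpha>) = 1)"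

text \<open>Since \<open>0 powr a = 0\<close> and the coordinates are positive, the product vanishes as soon as one
  coefficient \<open>d \<alpha>\<close> does.\<close>

definition DSONC :: "(real^'n) set \<Rightarrow> real^'n \<Rightarrow> (real^'n \<Rightarrow> real) set" where
  "DSONC A \<beta> = {exp_sum A \<beta> d d\<^sub>\<beta> | d d\<^sub>\<beta>.
     (\<forall>\<alpha>\<in>A. 0 \<le> d \<alpha>) \<and> - d\<^sub>\<beta> \<le> (\<Prod>\<alpha>\<in>A. d \<alpha> powr barycentric_coords A \<beta> \<alpha>)}"

definition tropical_hypersurface ::
    "'i set \<Rightarrow> ('i \<Rightarrow> real^'n \<Rightarrow> real) \<Rightarrow> (real^'n) set" where
  "tropical_hypersurface I l =
     {x. \<exists>i\<in>I. \<exists>j\<in>I. i \<noteq> j \<and>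
         l i x = Max ((\<lambda>k. l k x) ` I) \<and> l j x = Max ((\<lambda>k. l k x) ` I)}"

definition genus_zero :: "(real^'n) set \<Rightarrow> bool" where
  "genus_zero T \<longleftrightarrow> \<not> (\<exists>C\<in>components (- T). bounded C)"

end

theory Submission
  imports Defs
begin

text \<open>Put \<open>l a x = ln \<bar>c a\<bar> + x \<bullet> a\<close>. The barycentric average of the \<open>l a x\<close> over the vertices \<open>a\<close>
  exceeds \<open>l \<beta> x\<close> by a constant \<open>K\<close>, and membership in the DSONC cone means \<open>0 \<le> K\<close>, because
  exponentials are linearly independent. If \<open>0 \<le> K\<close>, then the inner term never dominates alone, and
  the regions of the vertices are unbounded. If \<open>K < 0\<close>, then it dominates at the point where
  all \<open>l a\<close> coincide, and its region is bounded because \<open>\<beta>\<close> is an interior point.\<close>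

section \<open>Linear independence of exponentials\<close>

text \<open>Along the ray spanned by a point \<open>m\<close> of maximal norm, the term of \<open>m\<close> grows fastest, which
  forces its coefficient to vanish.\<close>

lemma exponentials_independent:
  fixes a :: "'a::real_inner \<Rightarrow> real"
  assumes "finite S" "\<And>x. (\<Sum>s\<in>S. a s * exp (x \<bullet> s)) = 0" "s \<in> S"
  shows "a s = 0"
  using assms
proof (induction "card S" arbitrary: S s)
  case 0
  then show ?case by auto
next
  case (Suc k)
  have "Max (norm ` S) \<in> norm ` S"
    using Suc.prems by (intro Max_in) auto
  then obtain m where m: "m \<in> S" "norm m = Max (norm ` S)" by auto
  have max: "norm t \<le> norm m" if "t \<in> S" for t
    using that Suc.prems m by auto
  \<comment> \<open>Strict even when \<open>t\<close> and \<open>m\<close> have equal norms, because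
    the squared distance of distinct points is positive.\<close>
  have lt: "m \<bullet> t < m \<bullet> m" if "t \<in> S" "t \<noteq> m" for t
  proof -
    have "0 < (m - t) \<bullet> (m - t)" using that by simp
    also have "\<dots> = m \<bullet> m + t \<bullet> t - 2 * (m \<bullet> t)"
      by (simp add: algebra_simps inner_commute)
    finally have "2 * (m \<bullet> t) < m \<bullet> m + t \<bullet> t" by simp
    moreover have "t \<bullet> t \<le> m \<bullet> m"
      using max[OF that(1)] by (simp add: norm_le)
    ultimately show ?thesis by simp
  qed
  \<comment> \<open>The summands at the point \<open>\<tau> *\<^sub>R m\<close>, divided by
    \<open>exp (\<tau> * (m \<bullet> m))\<close>, so that every term except that of
    \<open>m\<close> decays.\<close>
  define g where "g t \<tau> = a t * exp (\<tau> * (m \<bullet> t - m \<bullet> m))" for t \<tau>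
  have lim: "(g t \<longlongrightarrow> (if t = m then a m else 0)) at_top" if "t \<in> S" for t
  proof (cases "t = m")
    case False
    have "filterlim (\<lambda>\<tau>. \<tau> * (m \<bullet> t - m \<bullet> m)) at_bot at_top"
      using lt[OF that False] unfolding mult.commute[of _ "m \<bullet> t - m \<bullet> m"]
      by (intro filterlim_tendsto_neg_mult_at_bot[OF tendsto_const] filterlim_ident) auto
    then have "((\<lambda>\<tau>. exp (\<tau> * (m \<bullet> t - m \<bullet> m))) \<longlongrightarrow> 0) at_top"
      by (rule filterlim_compose[OF exp_at_bot])
    then show ?thesis
      using False tendsto_mult_right_zero unfolding g_def by fastforce
  qed (simp add: g_def[abs_def])
  have "((\<lambda>\<tau>. \<Sum>t\<in>S. g t \<tau>) \<longlongrightarrow> (\<Sum>t\<in>S. if t = m then a m else 0)) at_top"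
    by (intro tendsto_sum lim)
  moreover have "(\<Sum>t\<in>S. g t \<tau>) = 0" for \<tau>
  proof -
    have "(\<Sum>t\<in>S. g t \<tau>) = exp (- \<tau> * (m \<bullet> m)) * (\<Sum>t\<in>S. a t * exp ((\<tau> *\<^sub>R m) \<bullet> t))"
      unfolding g_def sum_distrib_left
      by (intro sum.cong) (auto simp: algebra_simps simp flip: exp_add)
    then show ?thesis unfolding Suc.prems(2) by simp
  qed
  ultimately have am: "a m = 0"
    using Suc.prems(1) m(1) by (simp add: tendsto_const_iff)
  have "(\<Sum>s\<in>S - {m}. a s * exp (x \<bullet> s)) = 0" for x
    using Suc.prems(1,2) m(1) am by (simp add: sum_diff1)
  then show ?case
    using Suc.hyps(1)[of "S - {m}" s] Suc.hyps(2) Suc.prems m(1) am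
    by (cases "s = m") auto
qed

section \<open>Affine interpolation and barycentric coordinates\<close>

text \<open>Differences from a fixed point of \<open>A\<close> are linearly independent, so a linear
  functional can be prescribed on them. The lemma later yields functionals that single out one
  vertex, and the point where all vertex terms coincide.\<close>

lemma affine_independent_interpolation:
  fixes A :: "'a::euclidean_space set" and g :: "'a \<Rightarrow> real"
  assumes "\<not> affine_dependent A"
  obtains v m where "\<And>a. a \<in> A \<Longrightarrow> v \<bullet> a = g a + m"
proof (cases "A = {}")
  case False
  then obtain p where p: "p \<in> A" by auto
  have "\<not> dependent ((\<lambda>x. x - p) ` (A - {p}))"
    using assms affine_dependent_iff_dependent[of p "A - {p}"] p
    by (simp add: insert_absorb)
  then obtain h where h: "linear h" "\<And>y. y \<in> (\<lambda>x. x - p) ` (A - {p}) \<Longrightarrow> h y = g (y + p) - g p"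
    using linear_independent_extend[of _ "\<lambda>y. g (y + p) - g p"] by blast
  \<comment> \<open>The vector that represents the real functional \<open>h\<close> as an inner
    product.\<close>
  define v where "v = adjoint h 1"
  have v: "v \<bullet> x = h x" for x
    using adjoint_works[OF h(1), of x 1] by (simp add: v_def inner_commute)
  have "v \<bullet> a = g a + (h p - g p)" if "a \<in> A" for a
  proof (cases "a = p")
    case False
    have "h (a - p) = g a - g p" using h(2)[of "a - p"] that False by simp
    then show ?thesis using h(1) by (simp add: v linear_diff)
  qed (simp add: v)
  then show thesis using that by blast
qed (use that in blast)

text \<open>An interior point of a full-dimensional simplex has positive coordinates, and affine
  independence makes them unique. This resolves the \<open>THE\<close> in the definition.\<close>

lemma barycentric_coords_circuit:
  fixes A :: "(real^'n) set" and \<beta> :: "real^'n"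
  assumes "circuit A \<beta>"
  shows barycentric_coords_pos: "\<And>a. a \<in> A \<Longrightarrow> 0 < barycentric_coords A \<beta> a"
    and barycentric_coords_lt_1: "\<And>a. a \<in> A \<Longrightarrow> barycentric_coords A \<beta> a < 1"
    and barycentric_coords_combination: "(\<Sum>a\<in>A. barycentric_coords A \<beta> a *\<^sub>R a) = \<beta>"
    and barycentric_coords_sum: "(\<Sum>a\<in>A. barycentric_coords A \<beta> a) = 1"
proof -
  let ?P = "\<lambda>l. (\<forall>\<alpha>\<in>A. 0 < l \<alpha> \<and> l \<alpha> < 1) \<and> (\<forall>\<alpha>. \<alpha> \<notin> A \<longrightarrow> l \<alpha> = 0) \<and>
     (\<Sum>\<alpha>\<in>A. l \<alpha> *\<^sub>R \<alpha>) = \<beta> \<and> (\<Sum>\<alpha>\<in>A. l \<alpha>) = 1"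
  have cA: "card A = CARD('n) + 1" and ai: "\<not> affine_dependent A"
    and int: "\<beta> \<in> interior (convex hull A)"
    using assms by (auto simp: circuit_def)
  have fin: "finite A" using cA by (metis card.infinite Suc_eq_plus1 nat.distinct(1))
  obtain u where u: "\<forall>x\<in>A. 0 < u x" "sum u A = 1" "(\<Sum>x\<in>A. u x *\<^sub>R x) = \<beta>"
    using int interior_convex_hull_explicit_minimal[OF ai] cA by auto
  have u1: "u x < 1" if "x \<in> A" for x
  proof -
    \<comment> \<open>The dimension is at least one, so another vertex carries some of the total
      weight 1.\<close>
    have "card (A - {x}) = CARD('n)" using that fin cA by simp
    then have "A - {x} \<noteq> {}" by (metis card.empty zero_less_card_finite less_irrefl)
    then have "0 < sum u (A - {x})" using u fin by (intro sum_pos) auto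
    then show ?thesis using u that fin by (simp add: sum_diff1)
  qed
  have ex: "?P (\<lambda>x. if x \<in> A then u x else 0)"
    using u u1 by (simp cong: sum.cong)
  have unique: "l = l'" if l: "?P l" and l': "?P l'" for l l'
  proof
    fix x
    show "l x = l' x"
    proof (rule ccontr)
      assume neq: "l x \<noteq> l' x"
      then have "x \<in> A" using l l' by metis
      \<comment> \<open>Two different solutions would differ by an affine dependence.\<close>
      moreover have "sum (\<lambda>x. l x - l' x) A = 0" "(\<Sum>x\<in>A. (l x - l' x) *\<^sub>R x) = 0"
        using l l' by (simp_all add: sum_subtractf scaleR_diff_left)
      ultimately show False
        using ai neq affine_dependent_explicit_finite[OF fin] by fastforce
    qed
  qed
  have "\<exists>!l. ?P l" by (rule ex1I[where P = ?P, OF ex unique[OF _ ex]])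
  then have P: "?P (barycentric_coords A \<beta>)"
    unfolding barycentric_coords_def by (rule theI')
  then show "\<And>a. a \<in> A \<Longrightarrow> 0 < barycentric_coords A \<beta> a"
    "\<And>a. a \<in> A \<Longrightarrow> barycentric_coords A \<beta> a < 1"
    "(\<Sum>a\<in>A. barycentric_coords A \<beta> a *\<^sub>R a) = \<beta>"
    "(\<Sum>a\<in>A. barycentric_coords A \<beta> a) = 1"
    by auto
qed

lemma circuit_finite:
  fixes A :: "(real^'n) set"
  assumes "circuit A \<beta>"
  shows "finite A"
  using assms unfolding circuit_def by (metis card.infinite Suc_eq_plus1 nat.distinct(1))

text \<open>If \<open>\<beta>\<close> were a vertex, evaluating at \<open>\<beta>\<close> a
  functional that singles it out would give it the coordinate 1, but all coordinates are below
  1.\<close>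

lemma circuit_inner_point_notin:
  fixes A :: "(real^'n) set"
  assumes "circuit A \<beta>"
  shows "\<beta> \<notin> A"
proof
  assume \<beta>: "\<beta> \<in> A"
  obtain v m where v: "\<And>a. a \<in> A \<Longrightarrow> v \<bullet> a = (if a = \<beta> then 1 else 0) + m"
    using affine_independent_interpolation[of A "\<lambda>a. if a = \<beta> then 1 else 0"] assms
    by (auto simp: circuit_def)
  let ?l = "barycentric_coords A \<beta>"
  have "1 + m = v \<bullet> (\<Sum>a\<in>A. ?l a *\<^sub>R a)"
    using v[OF \<beta>] barycentric_coords_combination[OF assms] by simp
  also have "\<dots> = (\<Sum>a\<in>A. (if a = \<beta> then ?l a else 0) + ?l a * m)"
    by (simp add: inner_sum_right, intro sum.cong) (auto simp: v algebra_simps)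
  also have "\<dots> = ?l \<beta> + m"
    using \<beta> circuit_finite[OF assms] barycentric_coords_sum[OF assms]
    by (simp add: sum.distrib flip: sum_distrib_right)
  finally show False
    using barycentric_coords_lt_1[OF assms \<beta>] by simp
qed

section \<open>Membership in the DSONC cone\<close>

text \<open>Membership in \<open>DSONC\<close> asks for some coefficients representing the function;
  this identifies them with the given ones.\<close>

lemma exp_sum_eq_iff:
  fixes A :: "(real^'n) set"
  assumes "finite A" "\<beta> \<notin> A"
  shows "exp_sum A \<beta> d d\<^sub>\<beta> = exp_sum A \<beta> c c\<^sub>\<beta> \<longleftrightarrow> (\<forall>a\<in>A. d a = c a) \<and> d\<^sub>\<beta> = c\<^sub>\<beta>"
proof
  assume eq: "exp_sum A \<beta> d d\<^sub>\<beta> = exp_sum A \<beta> c c\<^sub>\<beta>"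
  \<comment> \<open>The inner coefficient is a separate argument, so at \<open>\<beta>\<close> it
    replaces the value of \<open>d\<close> and \<open>c\<close>.\<close>
  define b where "b s = (if s = \<beta> then d\<^sub>\<beta> - c\<^sub>\<beta> else d s - c s)" for s
  have "(\<Sum>s\<in>insert \<beta> A. b s * exp (x \<bullet> s)) = 0" for x
  proof -
    have "(\<Sum>s\<in>A. b s * exp (x \<bullet> s)) = (\<Sum>s\<in>A. d s * exp (x \<bullet> s)) - (\<Sum>s\<in>A. c s * exp (x \<bullet> s))"
      unfolding sum_subtractf[symmetric]
      using assms by (intro sum.cong) (auto simp: b_def algebra_simps)
    then show ?thesis
      using fun_cong[OF eq, of x] assms by (simp add: b_def exp_sum_def algebra_simps)
  qed
  then have b: "b s = 0" if "s \<in> insert \<beta> A" for s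
    using exponentials_independent[of "insert \<beta> A" b s] assms that by auto
  have "d a = c a" if "a \<in> A" for a
    using b[of a] that assms by (auto simp: b_def split: if_splits)
  moreover have "d\<^sub>\<beta> = c\<^sub>\<beta>" using b[of \<beta>] by (simp add: b_def)
  ultimately show "(\<forall>a\<in>A. d a = c a) \<and> d\<^sub>\<beta> = c\<^sub>\<beta>" by blast
qed (auto simp: exp_sum_def cong: sum.cong)

text \<open>The coefficients of \<open>f\<close> are unique and those on \<open>A\<close> are
  positive, so taking logarithms turns the weighted product into a weighted sum.\<close>

lemma circuit_function_DSONC_iff:
  fixes A :: "(real^'n) set"
  assumes "circuit_function A \<beta> c f" "c \<beta> < 0"
  shows "f \<in> DSONC A \<beta> \<longleftrightarrow> ln \<bar>c \<beta>\<bar> \<le> (\<Sum>a\<in>A. barycentric_coords A \<beta> a * ln (c a))"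
proof -
  have circ: "circuit A \<beta>" and pos: "\<And>a. a \<in> A \<Longrightarrow> 0 < c a" and f: "f = exp_sum A \<beta> c (c \<beta>)"
    using assms by (auto simp: circuit_function_def)
  note fin = circuit_finite[OF circ] and notin = circuit_inner_point_notin[OF circ]
  have "f \<in> DSONC A \<beta> \<longleftrightarrow> - c \<beta> \<le> (\<Prod>a\<in>A. c a powr barycentric_coords A \<beta> a)"
  proof
    assume "f \<in> DSONC A \<beta>"
    then obtain d d\<^sub>\<beta> where d: "exp_sum A \<beta> d d\<^sub>\<beta> = exp_sum A \<beta> c (c \<beta>)"
      "- d\<^sub>\<beta> \<le> (\<Prod>a\<in>A. d a powr barycentric_coords A \<beta> a)"
      unfolding DSONC_def f by (auto dest: sym)
    then show "- c \<beta> \<le> (\<Prod>a\<in>A. c a powr barycentric_coords A \<beta> a)"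
      using exp_sum_eq_iff[OF fin notin] by (simp cong: prod.cong)
  next
    assume "- c \<beta> \<le> (\<Prod>a\<in>A. c a powr barycentric_coords A \<beta> a)"
    then show "f \<in> DSONC A \<beta>"
      using pos unfolding DSONC_def f by (auto intro!: exI[of _ c] exI[of _ "c \<beta>"] less_imp_le)
  qed
  also have "(\<Prod>a\<in>A. c a powr barycentric_coords A \<beta> a)
      = exp (\<Sum>a\<in>A. barycentric_coords A \<beta> a * ln (c a))"
    unfolding exp_sum[OF fin] using pos by (intro prod.cong) (force simp: powr_def)+
  also have "- c \<beta> \<le> \<dots> \<longleftrightarrow> ln \<bar>c \<beta>\<bar> \<le> (\<Sum>a\<in>A. barycentric_coords A \<beta> a * ln (c a))"
    using assms(2) by (subst ln_le_cancel_iff[symmetric]) auto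
  finally show ?thesis .
qed

section \<open>Barycentric averages of affine terms\<close>

text \<open>The linear parts average to the linear part of the inner term, so only constants remain
  to be compared.\<close>

lemma circuit_combination:
  fixes A :: "(real^'n) set"
  assumes "circuit A \<beta>"
  shows "(\<Sum>a\<in>A. barycentric_coords A \<beta> a * (h a + x \<bullet> a))
    = (\<Sum>a\<in>A. barycentric_coords A \<beta> a * h a) + x \<bullet> \<beta>"
proof -
  have "x \<bullet> \<beta> = (\<Sum>a\<in>A. barycentric_coords A \<beta> a * (x \<bullet> a))"
    by (subst barycentric_coords_combination[OF assms, symmetric]) (simp add: inner_sum_right)
  then show ?thesis by (simp add: distrib_left sum.distrib)
qed

lemma circuit_combination_less:
  fixes A :: "(real^'n) set" and h :: "real^'n \<Rightarrow> real"
  assumes "circuit A \<beta>" "\<And>a. a \<in> A \<Longrightarrow> h a < M"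
  shows "(\<Sum>a\<in>A. barycentric_coords A \<beta> a * h a) < M"
proof -
  have "A \<noteq> {}" using assms(1) by (auto simp: circuit_def)
  then have "(\<Sum>a\<in>A. barycentric_coords A \<beta> a * h a) < (\<Sum>a\<in>A. barycentric_coords A \<beta> a * M)"
    using assms(2) barycentric_coords_pos[OF assms(1)] circuit_finite[OF assms(1)]
    by (intro sum_strict_mono mult_strict_left_mono) auto
  then show ?thesis
    using barycentric_coords_sum[OF assms(1)] by (simp flip: sum_distrib_right)
qed

section \<open>Regions of the tropical complement\<close>

text \<open>A finite maximum is attained, so off the hypersurface exactly one term attains it. This
  splits the complement into regions of strict domination.\<close>

lemma notin_tropical_hypersurface_iff:
  assumes "finite I" "I \<noteq> {}"
  shows "x \<notin> tropical_hypersurface I l \<longleftrightarrow> (\<exists>i\<in>I. \<forall>j\<in>I - {i}. l j x < l i x)"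
proof
  assume nt: "x \<notin> tropical_hypersurface I l"
  let ?M = "Max ((\<lambda>k. l k x) ` I)"
  have "?M \<in> (\<lambda>k. l k x) ` I" using assms by (intro Max_in) auto
  then obtain i where i: "i \<in> I" "?M = l i x" by auto
  have "l j x < l i x" if "j \<in> I - {i}" for j
  proof -
    have "l j x \<le> ?M" using that assms by simp
    moreover have "l j x \<noteq> ?M"
      using nt that i unfolding tropical_hypersurface_def
      by (metis (mono_tags, lifting) CollectI DiffE singletonI)
    ultimately show ?thesis using i by simp
  qed
  then show "\<exists>i\<in>I. \<forall>j\<in>I - {i}. l j x < l i x" using i by blast
next
  assume "\<exists>i\<in>I. \<forall>j\<in>I - {i}. l j x < l i x"
  then obtain i where i: "i \<in> I" "\<And>j. j \<in> I - {i} \<Longrightarrow> l j x < l i x" by auto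
  have "Max ((\<lambda>k. l k x) ` I) = l i x"
    using i assms by (intro Max_eqI) (auto simp: less_imp_le, force)
  then show "x \<notin> tropical_hypersurface I l"
    using i unfolding tropical_hypersurface_def
    by (auto, metis DiffI less_irrefl singletonD)
qed

text \<open>A vertex is exposed, so the region where its term dominates contains a ray from each of
  its points.\<close>

lemma vertex_region_unbounded:
  fixes A :: "(real^'n) set" and h :: "real^'n \<Rightarrow> real"
  assumes circ: "circuit A \<beta>" and p: "p \<in> A"
    and x: "\<And>j. j \<in> insert \<beta> A - {p} \<Longrightarrow> h j + x \<bullet> j < h p + x \<bullet> p"
    and C: "C \<in> components (- tropical_hypersurface (insert \<beta> A) (\<lambda>a x. h a + x \<bullet> a))" "x \<in> C"
  shows "\<not> bounded C"
proof
  let ?T = "tropical_hypersurface (insert \<beta> A) (\<lambda>a x. h a + x \<bullet> a)"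
  assume bd: "bounded C"
  note fin = circuit_finite[OF circ] and notin = circuit_inner_point_notin[OF circ]
  \<comment> \<open>The direction \<open>v\<close> exposes \<open>p\<close>: it is larger by 1 there
    than at the other vertices.\<close>
  obtain v m where v: "\<And>a. a \<in> A \<Longrightarrow> v \<bullet> a = (if a = p then 1 else 0) + m"
    using affine_independent_interpolation[of A "\<lambda>a. if a = p then 1 else 0"] circ
    by (auto simp: circuit_def)
  have v\<beta>: "v \<bullet> \<beta> \<le> v \<bullet> p"
  proof -
    \<comment> \<open>The summand 0 lets \<open>circuit_combination\<close> apply with the zero
      function for \<open>h\<close>.\<close>
    have "(\<Sum>a\<in>A. barycentric_coords A \<beta> a * (0 + v \<bullet> a))
        \<le> (\<Sum>a\<in>A. barycentric_coords A \<beta> a * (v \<bullet> p))"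
      using barycentric_coords_pos[OF circ] p
      by (intro sum_mono mult_left_mono) (auto simp: v less_imp_le)
    then show ?thesis
      unfolding circuit_combination[OF circ]
      by (simp add: barycentric_coords_sum[OF circ] flip: sum_distrib_right)
  qed
  have vle: "v \<bullet> j \<le> v \<bullet> p" if "j \<in> insert \<beta> A" for j
    using that v\<beta> p by (auto simp: v)
  have "v \<noteq> 0"
  proof
    assume v0: "v = 0"
    have "card (A - {p}) = CARD('n)" using p fin circ by (simp add: circuit_def)
    then obtain q where "q \<in> A" "q \<noteq> p"
      by (metis Diff_iff card.empty ex_in_conv insertI1 less_irrefl zero_less_card_finite)
    then show False using v[of p] v[of q] p v0 by simp
  qed
  \<comment> \<open>Along this ray the lead of the term of \<open>p\<close> over any other term
    never shrinks.\<close>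
  define R where "R = (\<lambda>t. x + t *\<^sub>R v) ` {0..}"
  have "R \<subseteq> - ?T"
  proof
    fix y assume "y \<in> R"
    then obtain t where t: "t \<ge> 0" "y = x + t *\<^sub>R v" by (auto simp: R_def)
    have "h j + y \<bullet> j < h p + y \<bullet> p" if "j \<in> insert \<beta> A - {p}" for j
      using x[OF that] mult_left_mono[OF vle[of j] t(1)] that
      by (simp add: t inner_add_left algebra_simps)
    then show "y \<in> - ?T"
      using p fin by (auto simp: notin_tropical_hypersurface_iff)
  qed
  moreover have "connected R"
    unfolding R_def by (intro connected_continuous_image continuous_intros) auto
  moreover have "x \<in> R" unfolding R_def by (auto intro: image_eqI[of _ _ 0])
  ultimately have "R \<subseteq> C"
    using C components_maximal[OF C(1)] by blast
  then obtain B where B: "\<And>y. y \<in> R \<Longrightarrow> norm y \<le> B"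
    using bd by (meson bounded_iff subset_iff)
  \<comment> \<open>Chosen so that even after subtracting \<open>norm x\<close> the length exceeds
    \<open>B\<close>.\<close>
  define t where "t = (\<bar>B\<bar> + norm x + 1) / norm v"
  have "t * norm v = \<bar>B\<bar> + norm x + 1" "t \<ge> 0" using \<open>v \<noteq> 0\<close> by (auto simp: t_def)
  moreover have "norm (x + t *\<^sub>R v) \<ge> norm (t *\<^sub>R v) - norm x"
    by (metis add.commute norm_diff_ineq)
  moreover have "norm (x + t *\<^sub>R v) \<le> B" using \<open>t \<ge> 0\<close> by (intro B) (auto simp: R_def)
  ultimately show False by simp
qed

text \<open>Domination bounds the excess of \<open>x \<bullet> a\<close> over
  \<open>x \<bullet> \<beta>\<close> by a constant on the vertices, hence on their hull. The hull
  contains a ball about \<open>\<beta>\<close>, where the excess reaches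
  \<open>e * norm x\<close>.\<close>

lemma inner_region_bounded:
  fixes A :: "(real^'n) set" and h :: "real^'n \<Rightarrow> real"
  assumes circ: "circuit A \<beta>"
  shows "bounded {x. \<forall>a\<in>A. h a + x \<bullet> a < h \<beta> + x \<bullet> \<beta>}"
proof -
  note fin = circuit_finite[OF circ]
  obtain e where e: "e > 0" "cball \<beta> e \<subseteq> convex hull A"
    using circ by (auto simp: circuit_def mem_interior_cball)
  define K where "K = (\<Sum>a\<in>A. \<bar>h \<beta> - h a\<bar>)"
  have "norm x \<le> K / e" if x: "\<forall>a\<in>A. h a + x \<bullet> a < h \<beta> + x \<bullet> \<beta>" for x
  proof -
    \<comment> \<open>The maximizer of the inner product with \<open>x\<close> on the ball; for
      \<open>x = 0\<close> it is \<open>\<beta>\<close> itself.\<close>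
    define y where "y = \<beta> + e *\<^sub>R sgn x"
    have "y \<in> cball \<beta> e"
      using e(1) by (auto simp: y_def dist_norm norm_sgn)
    moreover have "convex hull A \<subseteq> {y. x \<bullet> y \<le> x \<bullet> \<beta> + K}"
    proof (rule hull_minimal)
      show "A \<subseteq> {y. x \<bullet> y \<le> x \<bullet> \<beta> + K}"
      proof
        fix a assume a: "a \<in> A"
        have "\<bar>h \<beta> - h a\<bar> \<le> K" unfolding K_def using a fin by (intro member_le_sum) auto
        then show "a \<in> {y. x \<bullet> y \<le> x \<bullet> \<beta> + K}" using x a by fastforce
      qed
    qed (rule convex_halfspace_le)
    ultimately have "x \<bullet> y \<le> x \<bullet> \<beta> + K" using e(2) by auto
    moreover have "x \<bullet> y = x \<bullet> \<beta> + e * norm x"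
      by (cases "x = 0") (auto simp: y_def inner_add_right sgn_div_norm power2_eq_square
          simp flip: power2_norm_eq_inner)
    ultimately show ?thesis using e(1) by (simp add: field_simps)
  qed
  then show ?thesis by (intro boundedI[of _ "K / e"]) auto
qed

section \<open>Genus and the sign of the constant\<close>

lemma circuit_genus_zero_iff:
  fixes A :: "(real^'n) set" and h :: "real^'n \<Rightarrow> real"
  assumes circ: "circuit A \<beta>"
  shows "genus_zero (tropical_hypersurface (insert \<beta> A) (\<lambda>a x. h a + x \<bullet> a))
    \<longleftrightarrow> h \<beta> \<le> (\<Sum>a\<in>A. barycentric_coords A \<beta> a * h a)"
proof
  let ?T = "tropical_hypersurface (insert \<beta> A) (\<lambda>a x. h a + x \<bullet> a)"
  note fin = circuit_finite[OF circ] and notin = circuit_inner_point_notin[OF circ]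
  have T: "x \<notin> ?T \<longleftrightarrow> (\<exists>i\<in>insert \<beta> A. \<forall>j\<in>insert \<beta> A - {i}. h j + x \<bullet> j < h i + x \<bullet> i)" for x
    using fin by (intro notin_tropical_hypersurface_iff) auto
  show "genus_zero ?T" if le: "h \<beta> \<le> (\<Sum>a\<in>A. barycentric_coords A \<beta> a * h a)"
    unfolding genus_zero_def
  proof clarify
    fix C assume C: "C \<in> components (- ?T)" and bd: "bounded C"
    obtain x where x: "x \<in> C" using in_components_nonempty[OF C] by auto
    then have "x \<notin> ?T" using in_components_subset[OF C] by auto
    then obtain p where p: "p \<in> insert \<beta> A"
      "\<And>j. j \<in> insert \<beta> A - {p} \<Longrightarrow> h j + x \<bullet> j < h p + x \<bullet> p"
      using T by meson
    show False
    proof (cases "p = \<beta>")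
      case True
      \<comment> \<open>Domination by the inner term passes to the average, where the
        \<open>x\<close>-dependent parts cancel and contradict \<open>le\<close>.\<close>
      then have "(\<Sum>a\<in>A. barycentric_coords A \<beta> a * (h a + x \<bullet> a)) < h \<beta> + x \<bullet> \<beta>"
        using p notin by (intro circuit_combination_less[OF circ]) auto
      then show False using le unfolding circuit_combination[OF circ] by simp
    next
      case False
      then show False
        using vertex_region_unbounded[OF circ _ p(2) C x] bd p(1) by auto
    qed
  qed
  show "h \<beta> \<le> (\<Sum>a\<in>A. barycentric_coords A \<beta> a * h a)" if g0: "genus_zero ?T"
  proof (rule ccontr)
    assume lt: "\<not> ?thesis"
    \<comment> \<open>At this \<open>x\<close> every vertex term has the same value
      \<open>m\<close>, which is therefore also their average.\<close>
    obtain x m where x: "\<And>a. a \<in> A \<Longrightarrow> x \<bullet> a = - h a + m"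
      using affine_independent_interpolation[of A "\<lambda>a. - h a"] circ by (auto simp: circuit_def)
    define R where "R = {x. \<forall>a\<in>A. h a + x \<bullet> a < h \<beta> + x \<bullet> \<beta>}"
    \<comment> \<open>\<open>R\<close> and \<open>R'\<close> are disjoint open sets covering the
      complement, so a component that meets \<open>R\<close> stays inside it. For this,
      \<open>R'\<close> need not separate the vertices from each other.\<close>
    define R' where "R' = (\<Union>a\<in>A. {x. h \<beta> + x \<bullet> \<beta> < h a + x \<bullet> a})"
    have "m = (\<Sum>a\<in>A. barycentric_coords A \<beta> a * (h a + x \<bullet> a))"
      using barycentric_coords_sum[OF circ] by (simp add: x flip: sum_distrib_right)
    also have "\<dots> < h \<beta> + x \<bullet> \<beta>"
      using lt unfolding circuit_combination[OF circ] by simp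
    finally have xR: "x \<in> R" by (simp add: R_def x)
    have "x \<in> - ?T" using xR notin by (auto simp: T R_def)
    then obtain C where C: "C \<in> components (- ?T)" "x \<in> C"
      using Union_components[of "- ?T"] by blast
    have "R = (\<Inter>a\<in>A. {x. h a + x \<bullet> a < h \<beta> + x \<bullet> \<beta>})" by (auto simp: R_def)
    then have "open R"
      using fin by (auto intro!: open_INT open_Collect_less continuous_intros)
    moreover have "open R'"
      unfolding R'_def by (auto intro!: open_UN open_Collect_less continuous_intros)
    moreover have "- ?T \<subseteq> R \<union> R'"
    proof
      fix y assume "y \<in> - ?T"
      then obtain p where p: "p \<in> insert \<beta> A"
        "\<And>j. j \<in> insert \<beta> A - {p} \<Longrightarrow> h j + y \<bullet> j < h p + y \<bullet> p"
        using T by (meson ComplD)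
      show "y \<in> R \<union> R'"
        using p notin unfolding R_def R'_def by (cases "p = \<beta>") auto
    qed
    then have "C \<subseteq> R \<union> R'" using in_components_subset[OF C(1)] by blast
    moreover have "R \<inter> R' = {}" by (fastforce simp: R_def R'_def)
    ultimately have "C \<subseteq> R"
      using connectedD[OF in_components_connected[OF C(1)], of R R'] C(2) xR by blast
    then have "bounded C"
      using inner_region_bounded[OF circ, of h] bounded_subset unfolding R_def by blast
    then show False using g0 C(1) by (auto simp: genus_zero_def)
  qed
qed

theorem corollary6p3:
  fixes A :: "(real^'n) set" and \<beta> :: "real^'n"
    and c :: "real^'n \<Rightarrow> real" and f :: "real^'n \<Rightarrow> real"
  assumes "circuit_function A \<beta> c f"
    and "c \<beta> < 0"
  shows "f \<in> DSONC A \<beta> \<longleftrightarrow>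
    genus_zero (tropical_hypersurface (insert \<beta> A) (\<lambda>\<alpha> x. ln \<bar>c \<alpha>\<bar> + x \<bullet> \<alpha>))"
proof -
  have circ: "circuit A \<beta>" and pos: "\<And>a. a \<in> A \<Longrightarrow> 0 < c a"
    using assms(1) by (auto simp: circuit_function_def)
  have "(\<Sum>a\<in>A. barycentric_coords A \<beta> a * ln \<bar>c a\<bar>) = (\<Sum>a\<in>A. barycentric_coords A \<beta> a * ln (c a))"
    using pos by (intro sum.cong) (simp_all add: abs_of_pos)
  then show ?thesis
    using circuit_function_DSONC_iff[OF assms] circuit_genus_zero_iff[OF circ] by simp
qed

end
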